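(* Let $|\omega|<\tfrac12$, let $B$, $\Psi$, $W_\omega$, $a$, $\mu$, $Q$, $C_\omega$, $D_\omega$ be the functions attached to the zero-slope corrected three-mode core as defined in the context, and let $$K_\Psi(x,y)=\int_0^\infty W_\omega(u+2x,u+2y)\,\Psi(u+2x)\,\Psi(u+2y)\,du,\qquad x,y\ge0,$$ be the same-sign kernel of the finite core. Then for all $x,y\ge0$, $$K_\Psi(x,y)=C_\omega(2x,2y)\,B(2x)\,B(2y)+\int_0^\infty D_\omega(u+2x,u+2y)\,B(u+2x)\,B(u+2y)\,du .$$
   Context: For $n\ge1$ let $\phi_n(t)=2(2\pi^2n^4e^{9t/2}-3\pi n^2e^{5t/2})e^{-\pi n^2e^{2t}}$ and $B_n(v)=e^{v/4}e^{-\pi n^2e^v}$. Put $\alpha_3=-\dfrac{\phi_1'(0)+\phi_2'(0)}{\phi_3'(0)}$ (right derivatives at $0$; numerically $\alpha_3\approx 1.0000000016838$), and $$B(v)=B_1(v)+B_2(v)+\alpha_3B_3(v),\qquad \Psi(v)=4B''(v)-\tfrac14B(v),\qquad v\ge 0,$$ so that $\Psi(v)=\widetilde\Phi_3(v/2)$ with $\widetilde\Phi_3=\phi_1+\phi_2+\alpha_3\phi_3$. For $s,t\ge0$ set $U=\frac{s+t}{2}$ and $W_\omega(s,t)=U\cosh(\omega U)$, and define $$a(v)=-\frac{B'(v)}{B(v)},\qquad \mu(v)=\frac{\Psi(v)}{B(v)},\qquad Q(s,t)=a(s)+a(t),$$ $$C_\omega(s,t)=\frac{W_\omega(s,t)\,\mu(s)\,\mu(t)}{Q(s,t)},\qquad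 D_\omega(s,t)=(\partial_s+\partial_t)C_\omega(s,t).$$ *)

theory Defs
  imports "HOL-Analysis.Analysis"
begin

definition phi :: "nat \<Rightarrow> real \<Rightarrow> real" where
  "phi n t = 2 * (2 * pi\<^sup>2 * real n ^ 4 * exp (9 * t / 2) - 3 * pi * (real n)\<^sup>2 * exp (5 * t / 2))
               * exp (- pi * (real n)\<^sup>2 * exp (2 * t))"

definition right_deriv :: "(real \<Rightarrow> real) \<Rightarrow> real \<Rightarrow> real" where
  "right_deriv f x = vector_derivative f (at_right x)"

definition alpha3 :: real where
  "alpha3 = - (right_deriv (phi 1) 0 + right_deriv (phi 2) 0) / right_deriv (phi 3) 0"

definition Phi3 :: "real \<Rightarrow> real" where
  "Phi3 t = phi 1 t + phi 2 t + alpha3 * phi 3 t"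

definition Bmode :: "nat \<Rightarrow> real \<Rightarrow> real" where
  "Bmode n v = exp (v / 4) * exp (- pi * (real n)\<^sup>2 * exp v)"

text \<open>
  The explicit formula makes \<open>Bcore\<close> smooth on the whole real line, so the two-sided derivatives
  used below agree at \<open>0\<close> with the one-sided ones of its restriction to the half-line.
\<close>

definition Bcore :: "real \<Rightarrow> real" where
  "Bcore v = Bmode 1 v + Bmode 2 v + alpha3 * Bmode 3 v"

definition Psi :: "real \<Rightarrow> real" where
  "Psi v = 4 * deriv (deriv Bcore) v - Bcore v / 4"

lemma Psi_eq_Phi3: "Psi v = Phi3 (v / 2)"
proof -
  define c where "c n = pi * (real n)\<^sup>2" for n :: nat
  have d1: "(Bmode n has_field_derivative (1/4 - c n * exp v) * Bmode n v) (at v)" for n v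
    unfolding Bmode_def c_def by (auto intro!: derivative_eq_intros simp: field_simps)
  have d2: "((\<lambda>v. (1/4 - c n * exp v) * Bmode n v) has_field_derivative
      ((1/4 - c n * exp v)\<^sup>2 - c n * exp v) * Bmode n v) (at v)" for n v
    by (auto intro!: derivative_eq_intros d1 simp: field_simps power2_eq_square)
  have e1: "deriv Bcore = (\<lambda>v. (1/4 - c 1 * exp v) * Bmode 1 v + (1/4 - c 2 * exp v) * Bmode 2 v
      + alpha3 * ((1/4 - c 3 * exp v) * Bmode 3 v))"
    unfolding Bcore_def
    by (intro ext DERIV_imp_deriv DERIV_add DERIV_cmult d1)
  have e2: "deriv (deriv Bcore) v = ((1/4 - c 1 * exp v)\<^sup>2 - c 1 * exp v) * Bmode 1 v
      + ((1/4 - c 2 * exp v)\<^sup>2 - c 2 * exp v) * Bmode 2 v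
      + alpha3 * (((1/4 - c 3 * exp v)\<^sup>2 - c 3 * exp v) * Bmode 3 v)"
    unfolding e1 by (intro DERIV_imp_deriv DERIV_add DERIV_cmult d2)
  have ph: "phi n (v / 2) = (4 * ((1/4 - c n * exp v)\<^sup>2 - c n * exp v) - 1/4) * Bmode n v" for n
  proof -
    have "exp (9 * v / 4) = (exp v)\<^sup>2 * exp (v / 4)" "exp (5 * v / 4) = exp v * exp (v / 4)"
      by (simp_all flip: exp_add exp_double)
    moreover have "9 * (v / 2) / 2 = 9 * v / 4" "5 * (v / 2) / 2 = 5 * v / 4" "2 * (v / 2) = v"
      by simp_all
    ultimately have "phi n (v / 2) = 2 * (2 * pi\<^sup>2 * real n ^ 4 * ((exp v)\<^sup>2 * exp (v / 4))
        - 3 * pi * (real n)\<^sup>2 * (exp v * exp (v / 4))) * exp (- pi * (real n)\<^sup>2 * exp v)"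
      unfolding phi_def by metis
    then show ?thesis
      unfolding Bmode_def c_def by (simp add: field_simps power2_eq_square power4_eq_xxxx)
  qed
  show ?thesis
    unfolding Psi_def Phi3_def e2 ph unfolding Bcore_def by (simp add: algebra_simps)
qed

definition W :: "real \<Rightarrow> real \<Rightarrow> real \<Rightarrow> real" where
  "W \<omega> s t = (let U = (s + t) / 2 in U * cosh (\<omega> * U))"

definition a :: "real \<Rightarrow> real" where
  "a v = - deriv Bcore v / Bcore v"

definition mu :: "real \<Rightarrow> real" where
  "mu v = Psi v / Bcore v"

definition Q :: "real \<Rightarrow> real \<Rightarrow> real" where
  "Q s t = a s + a t"

definition C :: "real \<Rightarrow> real \<Rightarrow> real \<Rightarrow> real" where
  "C \<omega> s t = W \<omega> s t * mu s * mu t / Q s t"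

text \<open>
  \<open>C \<omega>\<close> lives on the closed quadrant \<open>s, t \<ge> 0\<close>; accordingly the partial derivatives are taken
  within \<open>{0..}\<close>, hence are one-sided on the boundary.
\<close>

definition D :: "real \<Rightarrow> real \<Rightarrow> real \<Rightarrow> real" where
  "D \<omega> s t = vector_derivative (\<lambda>\<sigma>. C \<omega> \<sigma> t) (at s within {0..})
            + vector_derivative (\<lambda>\<tau>. C \<omega> s \<tau>) (at t within {0..})"

definition K_Psi :: "real \<Rightarrow> real \<Rightarrow> real \<Rightarrow> real" where
  "K_Psi \<omega> x y =
     (LBINT u:{0..}. W \<omega> (u + 2 * x) (u + 2 * y) * Psi (u + 2 * x) * Psi (u + 2 * y))"

end

theory Submission
  imports Defs
begin

text \<open>
  Since \<open>B' = - a B\<close> and \<open>\<Psi> = \<mu> B\<close>, the function \<open>F u = C(u + 2x, u + 2y) B(u + 2x) B(u + 2y)\<close>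
  satisfies \<open>F' = D B B - C Q B B = D B B - W \<Psi> \<Psi>\<close>, and the claim is the fundamental theorem of
  calculus on the half-line.  This needs \<open>B > 0\<close> and \<open>Q > 0\<close>; a crude bound
  \<open>\<bar>\<alpha>\<^sub>3\<bar> \<le> e\<^bsup>8\<pi>\<^esup> / 100\<close> suffices, because \<open>B\<^sub>3 = e\<^bsup>- 8\<pi> exp v\<^esup> B\<^sub>1\<close>, so that the first mode
  dominates the third.  All ratios \<open>B\<^bsup>(k)\<^esup> / B\<close>, hence \<open>C\<close> and \<open>D\<close>, grow at most exponentially,
  whereas \<open>B\<close> decays faster than every exponential; this gives integrability and \<open>F \<rightarrow> 0\<close>.
\<close>

section \<open>Size of the coefficient \<open>alpha3\<close>\<close>

lemma right_deriv_phi: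
  "right_deriv (phi n) 0 =
     (let c = pi * (real n)\<^sup>2 in c * (- 8 * c\<^sup>2 + 30 * c - 15) * exp (- c))"
proof -
  define c where "c = pi * (real n)\<^sup>2"
  have eq: "phi n = (\<lambda>t. 2 * (2 * c\<^sup>2 * exp (9 * t / 2) - 3 * c * exp (5 * t / 2)) * exp (- c * exp (2 * t)))"
    by (auto simp: phi_def c_def power_mult_distrib)
  have "(phi n has_real_derivative c * (- 8 * c\<^sup>2 + 30 * c - 15) * exp (- c)) (at 0 within {0<..})"
    unfolding eq by (auto intro!: derivative_eq_intros simp: algebra_simps power2_eq_square)
  then have "(phi n has_vector_derivative c * (- 8 * c\<^sup>2 + 30 * c - 15) * exp (- c)) (at_right 0)"
    by (simp add: has_real_derivative_iff_has_vector_derivative)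
  then show ?thesis
    unfolding right_deriv_def Let_def c_def[symmetric]
    by (intro vector_derivative_within) (auto simp: trivial_limit_at_right_real)
qed

text \<open>
  The terms for the first two modes nearly cancel, so the sign of \<^const>\<open>alpha3\<close> would require
  six-digit numerics; only its size is estimated.
\<close>

lemma abs_alpha3_le: "\<bar>alpha3\<bar> \<le> exp (8 * pi) / 100"
proof -
  have pi: "3 < pi" "pi < 4" using pi_gt3 pi_less_4 by auto
  have sq: "9 < pi\<^sup>2" "pi\<^sup>2 < 16"
    using mult_strict_mono[of 3 pi 3 pi] mult_strict_mono[of pi 4 pi 4] pi
    by (auto simp: power2_eq_square)
  \<comment> \<open>A common unit: both numerator terms are bounded by multiples of
    \<open>pi * E\<close>, the denominator from below by a multiple of
    \<open>pi * E * exp (- (8 * pi))\<close>, so \<open>pi * E\<close> cancels in the quotient and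
    \<open>exp (8 * pi)\<close> remains.\<close>
  define E where "E = exp (- pi)"
  have E: "E > 0" by (simp add: E_def)
  \<comment> \<open>The boxes for pi and its square put the bracket between -53 and 33; for the
    third mode they give at least 4767 in absolute value.\<close>
  have "\<bar>- 8 * pi\<^sup>2 + 30 * pi - 15\<bar> \<le> 60" using pi sq by linarith
  then have 1: "\<bar>right_deriv (phi 1) 0\<bar> \<le> pi * 60 * E"
    unfolding right_deriv_phi Let_def by (auto simp: abs_mult E_def)
  \<comment> \<open>Since e >= 2 and 3 pi > 9, the second mode carries an extra factor below 1/512,
    and 4 * 2100 / 512 < 17.\<close>
  have "2 ^ 9 \<le> exp (1::real) ^ 9"
    using exp_ge_add_one_self[of "1::real"] by (intro power_mono) auto
  also have "\<dots> = exp 9" by (simp flip: exp_of_nat_mult)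
  also have "\<dots> \<le> exp (3 * pi)" using pi by simp
  finally have "exp (- (3 * pi)) \<le> 1 / 512"
    by (simp add: exp_minus field_simps)
  then have e: "exp (- (4 * pi)) \<le> E / 512"
    unfolding E_def using exp_add[of "-(3 * pi)" "- pi"] by (simp add: field_simps)
  have "\<bar>- 128 * pi\<^sup>2 + 120 * pi - 15\<bar> \<le> 2100" using pi sq by linarith
  then have "4 * pi * \<bar>- 128 * pi\<^sup>2 + 120 * pi - 15\<bar> * exp (- (4 * pi)) \<le> 4 * pi * 2100 * (E / 512)"
    using e by (intro mult_mono) auto
  also have "4 * pi * \<bar>- 128 * pi\<^sup>2 + 120 * pi - 15\<bar> * exp (- (4 * pi)) = \<bar>right_deriv (phi 2) 0\<bar>"
    unfolding right_deriv_phi Let_def by (simp add: abs_mult power_mult_distrib mult.commute)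
  finally have 2: "\<bar>right_deriv (phi 2) 0\<bar> \<le> pi * 17 * E" using E pi by (simp add: field_simps)
  have "4700 \<le> \<bar>- 648 * pi\<^sup>2 + 270 * pi - 15\<bar>" using pi sq by linarith
  then have "9 * pi * 4700 * exp (- (9 * pi)) \<le> 9 * pi * \<bar>- 648 * pi\<^sup>2 + 270 * pi - 15\<bar> * exp (- (9 * pi))"
    by (intro mult_mono) auto
  also have "\<dots> = \<bar>right_deriv (phi 3) 0\<bar>"
    unfolding right_deriv_phi Let_def by (simp add: abs_mult power_mult_distrib mult.commute)
  also have "exp (- (9 * pi)) = E * exp (- (8 * pi))" by (simp add: E_def flip: exp_add)
  finally have 3: "9 * pi * 4700 * (E * exp (- (8 * pi))) \<le> \<bar>right_deriv (phi 3) 0\<bar>" .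
  have "\<bar>right_deriv (phi 1) 0 + right_deriv (phi 2) 0\<bar> \<le> pi * 77 * E" using 1 2 by linarith
  then have "\<bar>right_deriv (phi 1) 0 + right_deriv (phi 2) 0\<bar> / \<bar>right_deriv (phi 3) 0\<bar>
      \<le> pi * 77 * E / (9 * pi * 4700 * (E * exp (- (8 * pi))))"
    using 3 E pi by (intro frac_le) simp_all
  then have "\<bar>alpha3\<bar> \<le> pi * 77 * E / (9 * pi * 4700 * (E * exp (- (8 * pi))))"
    unfolding alpha3_def by (simp only: abs_divide abs_minus_cancel)
  also have "\<dots> = 77 / 42300 * exp (8 * pi)" using E by (simp add: exp_minus field_simps)
  also have "\<dots> \<le> exp (8 * pi) / 100" by simp
  finally show ?thesis .
qed

section \<open>Comparison of the three modes\<close>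

lemma Bmode_pos: "Bmode n v > 0"
  by (simp add: Bmode_def)

lemma Bmode_antimono: "m \<le> n \<Longrightarrow> Bmode n v \<le> Bmode m v"
  unfolding Bmode_def by (auto intro!: mult_left_mono mult_right_mono power_mono)

text \<open>The ratio of the third mode to the first is largest at v = 0, where it equals
  \<open>exp (- (8 * pi))\<close> and exactly cancels the exponential in
  \<open>abs_alpha3_le\<close>.\<close>

lemma alpha3_Bmode_le:
  assumes "v \<ge> 0"
  shows "\<bar>alpha3\<bar> * Bmode 3 v \<le> Bmode 1 v / 100"
proof -
  have "8 * pi * 1 \<le> 8 * pi * exp v" using assms by (intro mult_left_mono) auto
  then have "exp (8 * pi) * exp (- (8 * pi * exp v)) \<le> 1" by (simp flip: exp_add)
  then have *: "exp (8 * pi) / 100 * exp (- (8 * pi * exp v)) \<le> 1 / 100" by simp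
  have "Bmode 3 v = exp (- (8 * pi * exp v)) * Bmode 1 v"
    by (simp add: Bmode_def flip: exp_add)
  then have "\<bar>alpha3\<bar> * Bmode 3 v \<le> exp (8 * pi) / 100 * exp (- (8 * pi * exp v)) * Bmode 1 v"
    using mult_right_mono[OF abs_alpha3_le, of "Bmode 3 v"] Bmode_pos[of 3 v] by simp
  also have "\<dots> \<le> 1 / 100 * Bmode 1 v"
    by (intro mult_right_mono *) (simp add: Bmode_pos less_imp_le)
  finally show ?thesis by simp
qed

section \<open>Closed-form derivatives of the core\<close>

text \<open>With x = exp v, d/dv acts on p(x) times the n-th mode as p -> x p' + (1/4 - pi n^2 x) p.
  Keeping the factor as a polynomial in x treats all orders of derivative at once and makes
  exponential growth evident.\<close>

definition mode_step :: "nat \<Rightarrow> real poly \<Rightarrow> real poly" where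
  "mode_step n p = pCons 0 (pderiv p) + [:1/4, - pi * (real n)\<^sup>2:] * p"

definition mode_poly :: "nat \<Rightarrow> nat \<Rightarrow> real poly" where
  "mode_poly k n = (mode_step n ^^ k) 1"

definition Bcore_deriv :: "nat \<Rightarrow> real \<Rightarrow> real" where
  "Bcore_deriv k v = poly (mode_poly k 1) (exp v) * Bmode 1 v + poly (mode_poly k 2) (exp v) * Bmode 2 v
      + alpha3 * (poly (mode_poly k 3) (exp v) * Bmode 3 v)"

lemma Bcore_deriv_0: "Bcore_deriv 0 = Bcore"
  by (simp add: fun_eq_iff Bcore_deriv_def Bcore_def mode_poly_def)

lemma DERIV_mode:
  "((\<lambda>v. poly p (exp v) * Bmode n v) has_field_derivative poly (mode_step n p) (exp v) * Bmode n v) (at v)"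
proof -
  have B: "(Bmode n has_field_derivative (1/4 - pi * (real n)\<^sup>2 * exp v) * Bmode n v) (at v)"
    unfolding Bmode_def by (auto intro!: derivative_eq_intros simp: field_simps)
  have p: "((\<lambda>v. poly p (exp v)) has_field_derivative poly (pderiv p) (exp v) * exp v) (at v)"
    by (rule DERIV_chain2[OF poly_DERIV DERIV_exp])
  show ?thesis
    by (rule DERIV_cong[OF DERIV_mult[OF p B]]) (simp add: mode_step_def algebra_simps)
qed

lemma DERIV_Bcore_deriv: "(Bcore_deriv k has_field_derivative Bcore_deriv (Suc k) v) (at v)"
  using DERIV_add[OF DERIV_add[OF DERIV_mode[of "mode_poly k 1" 1] DERIV_mode[of "mode_poly k 2" 2]]
          DERIV_cmult[OF DERIV_mode[of "mode_poly k 3" 3], of alpha3], of v]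
  unfolding Bcore_deriv_def mode_poly_def by simp

lemma deriv_Bcore_deriv: "deriv (Bcore_deriv k) = Bcore_deriv (Suc k)"
  by (intro ext DERIV_imp_deriv DERIV_Bcore_deriv)

section \<open>Bounds for the core and its logarithmic derivative\<close>

text \<open>The sign of \<open>alpha3\<close> is left open, so the third mode may count negatively;
  it then costs at most a hundredth of the first.\<close>

lemma Bcore_ge:
  assumes "v \<ge> 0" shows "Bmode 1 v / 2 \<le> Bcore v"
  using alpha3_Bmode_le[OF assms] Bmode_pos[of 1 v] Bmode_pos[of 2 v] Bmode_pos[of 3 v]
    mult_right_mono[OF abs_ge_minus_self[of alpha3], of "Bmode 3 v"]
  unfolding Bcore_def by linarith

lemma Bcore_le:
  assumes "v \<ge> 0" shows "Bcore v \<le> 3 * Bmode 1 v"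
  using alpha3_Bmode_le[OF assms] Bmode_pos[of 1 v] Bmode_pos[of 3 v] Bmode_antimono[of 1 2 v]
    mult_right_mono[OF abs_ge_self[of alpha3], of "Bmode 3 v"]
  unfolding Bcore_def by linarith

lemma Bcore_pos: "v \<ge> 0 \<Longrightarrow> Bcore v > 0"
  using Bcore_ge[of v] Bmode_pos[of 1 v] by linarith

text \<open>In -B' the n-th mode has coefficient n^2 c - 1/4 with c = pi exp v >= 3. The second term
  is nonnegative, and the third is at most (9c - 1/4)/100 times the first mode, so the first term
  wins.\<close>

lemma a_ge:
  assumes "v \<ge> 0" shows "a v \<ge> 1 / 2"
proof -
  define c where "c = pi * exp v"
  have "3 * 1 \<le> pi * exp v" using pi_gt3 assms by (intro mult_mono) auto
  then have c: "c \<ge> 3" by (simp add: c_def)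
  have "(9 * c - 1/4) * (\<bar>alpha3\<bar> * Bmode 3 v) \<le> (9 * c - 1/4) * (Bmode 1 v / 100)"
    using c by (intro mult_left_mono alpha3_Bmode_le assms) auto
  moreover have "\<bar>(9 * c - 1/4) * (alpha3 * Bmode 3 v)\<bar> = (9 * c - 1/4) * (\<bar>alpha3\<bar> * Bmode 3 v)"
    using c Bmode_pos[of 3 v] by (simp add: abs_mult)
  ultimately have 3: "(9 * c - 1/4) * (alpha3 * Bmode 3 v) \<ge> - ((9 * c - 1/4) * (Bmode 1 v / 100))"
    by linarith
  have 2: "(4 * c - 1/4) * Bmode 2 v \<ge> 0" using c Bmode_pos[of 2 v] by simp
  \<comment> \<open>The target 3/2 is half of the constant 3 in \<open>Bcore_le\<close>, which turns
    this into -B' >= B/2.\<close>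
  have 1: "3/2 * Bmode 1 v \<le> (c - 1/4 - (9 * c - 1/4) / 100) * Bmode 1 v"
  proof (rule mult_right_mono)
    show "3/2 \<le> c - 1/4 - (9 * c - 1/4) / 100" using c by (simp add: field_simps)
  qed (simp add: Bmode_pos less_imp_le)
  have dB: "- deriv Bcore v = (c - 1/4) * Bmode 1 v + (4 * c - 1/4) * Bmode 2 v
          + (9 * c - 1/4) * (alpha3 * Bmode 3 v)"
    unfolding Bcore_deriv_0[symmetric] deriv_Bcore_deriv
    by (simp add: Bcore_deriv_def mode_poly_def mode_step_def c_def algebra_simps)
  have "(c - 1/4 - (9 * c - 1/4) / 100) * Bmode 1 v = (c - 1/4) * Bmode 1 v - (9 * c - 1/4) * (Bmode 1 v / 100)"
    by (simp add: field_simps)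
  then have "1/2 * Bcore v \<le> - deriv Bcore v"
    using 1 2 3 Bcore_le[OF assms] unfolding dB by linarith
  then show ?thesis using Bcore_pos[OF assms] by (simp add: a_def field_simps)
qed

text \<open>A quadratic lower bound exp v >= v^2/2 already suffices: it makes the mode at least
  Gaussian in decay, and completing the square beats any linear rate \<open>m\<close>.\<close>

lemma Bmode_decay:
  assumes "v \<ge> 0" shows "Bmode 1 v \<le> exp ((m + 1/4)\<^sup>2) * exp (- m * v)"
proof -
  have "v\<^sup>2 / 2 \<le> exp v" using exp_lower_Taylor_quadratic[OF assms] assms by simp
  then have "3 * (v\<^sup>2 / 2) \<le> pi * exp v" using pi_gt3 by (intro mult_mono) auto
  moreover have "0 \<le> v\<^sup>2" by simp
  moreover have "(m + 1/4) * v \<le> (m + 1/4)\<^sup>2 + v\<^sup>2"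
  proof -
    have "0 \<le> (m + 1/4 - v)\<^sup>2 + (m + 1/4)\<^sup>2 + v\<^sup>2" by simp
    then show ?thesis by (simp add: power2_eq_square algebra_simps)
  qed
  ultimately have "v / 4 - pi * exp v \<le> (m + 1/4)\<^sup>2 - m * v"
    unfolding distrib_right by linarith
  then show ?thesis by (simp add: Bmode_def flip: exp_add)
qed

lemma Bcore_decay: "\<exists>K. \<forall>v\<ge>0. Bcore v \<le> K * exp (- m * v)"
proof (intro exI allI impI)
  fix v :: real assume "v \<ge> 0"
  then show "Bcore v \<le> 3 * exp ((m + 1/4)\<^sup>2) * exp (- m * v)"
    using Bcore_le[of v] Bmode_decay[of v m] by linarith
qed

section \<open>The algebra of functions of at most exponential growth\<close>

text \<open>Continuity is bundled with the bound so that one closure calculus supplies both the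
  measurability and the domination used for the integrals.\<close>

definition exp_growth :: "(real \<Rightarrow> real) \<Rightarrow> bool" where
  "exp_growth f \<longleftrightarrow> continuous_on {0..} f \<and> (\<exists>K m. \<forall>u\<ge>0. \<bar>f u\<bar> \<le> K * exp (m * u))"

lemma exp_growthI:
  assumes "continuous_on {0..} f" "\<And>u. u \<ge> 0 \<Longrightarrow> \<bar>f u\<bar> \<le> K * exp (m * u)"
  shows "exp_growth f"
  using assms unfolding exp_growth_def by blast

lemma exp_growth_bound:
  assumes "continuous_on {0..} f" "exp_growth g" "\<And>u. u \<ge> 0 \<Longrightarrow> \<bar>f u\<bar> \<le> g u"
  shows "exp_growth f"
proof -
  obtain K m where "\<forall>u\<ge>0. \<bar>g u\<bar> \<le> K * exp (m * u)" using assms(2) unfolding exp_growth_def by blast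
  then show ?thesis using assms(3) by (intro exp_growthI[OF assms(1), of K m]) (meson abs_ge_self order_trans)
qed

lemma exp_growth_const: "exp_growth (\<lambda>_. c)"
  by (rule exp_growthI[of _ "\<bar>c\<bar>" 0]) auto

lemma exp_growth_exp: "exp_growth (\<lambda>u. exp (c * u))"
  by (rule exp_growthI[of _ 1 c]) (auto intro!: continuous_intros)

lemma exp_growth_add:
  assumes "exp_growth f" "exp_growth g" shows "exp_growth (\<lambda>u. f u + g u)"
proof -
  obtain K m where 1: "\<forall>u\<ge>0. \<bar>f u\<bar> \<le> K * exp (m * u)" using assms(1) unfolding exp_growth_def by blast
  obtain L n where 2: "\<forall>u\<ge>0. \<bar>g u\<bar> \<le> L * exp (n * u)" using assms(2) unfolding exp_growth_def by blast
  \<comment> \<open>Nonnegative constants are what allows both rates to be raised to their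
    maximum.\<close>
  have K: "K \<ge> 0" "L \<ge> 0" using 1[rule_format, of 0] 2[rule_format, of 0] by auto
  show ?thesis
  proof (rule exp_growthI[of _ "K + L" "max m n"])
    fix u :: real assume u: "u \<ge> 0"
    have "\<bar>f u + g u\<bar> \<le> K * exp (m * u) + L * exp (n * u)" using 1 2 u abs_triangle_ineq[of "f u" "g u"]
      by (smt (verit))
    also have "\<dots> \<le> K * exp (max m n * u) + L * exp (max m n * u)"
      using K u by (intro add_mono mult_left_mono) (auto intro: mult_right_mono)
    finally show "\<bar>f u + g u\<bar> \<le> (K + L) * exp (max m n * u)" by (simp add: algebra_simps)
  qed (use assms in \<open>auto simp: exp_growth_def intro!: continuous_intros\<close>)
qed

lemma exp_growth_mult:
  assumes "exp_growth f" "exp_growth g" shows "exp_growth (\<lambda>u. f u * g u)"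
proof -
  obtain K m where 1: "\<forall>u\<ge>0. \<bar>f u\<bar> \<le> K * exp (m * u)" using assms(1) unfolding exp_growth_def by blast
  obtain L n where 2: "\<forall>u\<ge>0. \<bar>g u\<bar> \<le> L * exp (n * u)" using assms(2) unfolding exp_growth_def by blast
  have K: "K \<ge> 0" using 1[rule_format, of 0] by auto
  show ?thesis
  proof (rule exp_growthI[of _ "K * L" "m + n"])
    fix u :: real assume u: "u \<ge> 0"
    have "\<bar>f u\<bar> * \<bar>g u\<bar> \<le> (K * exp (m * u)) * (L * exp (n * u))"
      using 1 2 u K by (intro mult_mono) auto
    then show "\<bar>f u * g u\<bar> \<le> K * L * exp ((m + n) * u)"
      by (simp add: abs_mult exp_add algebra_simps)
  qed (use assms in \<open>auto simp: exp_growth_def intro!: continuous_intros\<close>)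
qed

lemma exp_growth_minus: "exp_growth f \<Longrightarrow> exp_growth (\<lambda>u. - f u)"
  using exp_growth_mult[OF exp_growth_const[of "-1"], of f] by simp

lemma exp_growth_diff: "exp_growth f \<Longrightarrow> exp_growth g \<Longrightarrow> exp_growth (\<lambda>u. f u - g u)"
  using exp_growth_add[OF _ exp_growth_minus, of f g] by simp

lemma exp_growth_abs: "exp_growth f \<Longrightarrow> exp_growth (\<lambda>u. \<bar>f u\<bar>)"
  unfolding exp_growth_def by (auto intro!: continuous_intros)

lemma exp_growth_id: "exp_growth (\<lambda>u. u)"
proof (rule exp_growthI[of _ 1 1])
  fix u :: real assume "u \<ge> 0"
  then show "\<bar>u\<bar> \<le> 1 * exp (1 * u)" using exp_ge_add_one_self[of u] by (smt (verit) mult_1)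
qed (auto intro!: continuous_intros)

lemma exp_growth_divide:
  assumes "exp_growth f" "exp_growth g" "c > 0" "\<And>u. u \<ge> 0 \<Longrightarrow> g u \<ge> c"
  shows "exp_growth (\<lambda>u. f u / g u)"
proof -
  have nz: "g u \<noteq> 0" if "u \<in> {0..}" for u using assms(4)[of u] that \<open>c > 0\<close> by auto
  have "exp_growth (\<lambda>u. inverse (g u))"
  proof (rule exp_growthI[of _ "inverse c" 0])
    fix u :: real assume "u \<ge> 0"
    then show "\<bar>inverse (g u)\<bar> \<le> inverse c * exp (0 * u)"
      using assms(4)[of u] \<open>c > 0\<close> by (auto intro!: le_imp_inverse_le)
  qed (use assms(2) nz in \<open>auto simp: exp_growth_def intro!: continuous_intros\<close>)
  from exp_growth_mult[OF assms(1) this] show ?thesis by (simp add: divide_inverse)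
qed

lemma exp_growth_shift:
  assumes "exp_growth f" "c \<ge> 0" shows "exp_growth (\<lambda>u. f (u + c))"
proof -
  obtain K m where 1: "\<forall>u\<ge>0. \<bar>f u\<bar> \<le> K * exp (m * u)" using assms(1) unfolding exp_growth_def by blast
  show ?thesis
  proof (rule exp_growthI[of _ "K * exp (m * c)" m])
    have "continuous_on {0..} f" using assms(1) by (simp add: exp_growth_def)
    moreover have "continuous_on {0..} (\<lambda>u. u + c)" by (intro continuous_intros)
    moreover have "(\<lambda>u. u + c) ` {0..} \<subseteq> {0..}" using assms(2) by auto
    ultimately show "continuous_on {0..} (\<lambda>u. f (u + c))" by (rule continuous_on_compose2)
    fix u :: real assume "u \<ge> 0"
    then show "\<bar>f (u + c)\<bar> \<le> K * exp (m * c) * exp (m * u)"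
      using 1[rule_format, of "u + c"] assms(2) by (simp add: algebra_simps exp_add)
  qed
qed

lemma exp_growth_poly_exp: "exp_growth (\<lambda>u. poly p (exp u))"
proof (induction p)
  case (pCons c p)
  have "exp_growth (\<lambda>u. c + exp (1 * u) * poly p (exp u))" by (intro exp_growth_add exp_growth_mult exp_growth_const exp_growth_exp pCons)
  then show ?case by simp
qed (simp add: exp_growth_const)

section \<open>Growth of the coefficients \<open>a\<close> and \<open>mu\<close>\<close>

text \<open>On the half-line, \<open>a\<close>, \<open>mu\<close> and their derivatives are
  polynomials in these ratios, so a single growth bound valid for every k covers them all.\<close>

definition Bcore_ratio :: "nat \<Rightarrow> real \<Rightarrow> real" where
  "Bcore_ratio k v = Bcore_deriv k v / Bcore v"

lemma DERIV_Bcore_ratio: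
  assumes "v \<ge> 0"
  shows "(Bcore_ratio k has_field_derivative Bcore_ratio (Suc k) v - Bcore_ratio k v * Bcore_ratio 1 v) (at v)"
proof -
  have B: "(Bcore has_field_derivative Bcore_deriv 1 v) (at v)"
    using DERIV_Bcore_deriv[of 0 v] by (simp add: Bcore_deriv_0)
  show ?thesis
    unfolding Bcore_ratio_def using Bcore_pos[OF assms]
    by (intro DERIV_cong[OF DERIV_divide[OF DERIV_Bcore_deriv B]]) (auto simp: field_simps)
qed

lemma continuous_on_DERIV_Ici:
  "(\<And>v. v \<ge> 0 \<Longrightarrow> (f has_field_derivative f' v) (at v)) \<Longrightarrow> continuous_on {0..} f" for f :: "real \<Rightarrow> real"
  by (intro continuous_at_imp_continuous_on ballI DERIV_isCont) auto

text \<open>Every mode in the numerator is at most the first mode, hence at most twice the core by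
  \<open>Bcore_ge\<close>; after division only polynomials in exp v remain.\<close>

lemma exp_growth_Bcore_ratio: "exp_growth (Bcore_ratio k)"
proof (rule exp_growth_bound)
  let ?P = "\<lambda>n v. \<bar>poly (mode_poly k n) (exp v)\<bar>"
  show "continuous_on {0..} (Bcore_ratio k)"
    by (rule continuous_on_DERIV_Ici[OF DERIV_Bcore_ratio])
  show "exp_growth (\<lambda>v. 2 * (?P 1 v + ?P 2 v + \<bar>alpha3\<bar> * ?P 3 v))"
    by (intro exp_growth_mult exp_growth_add exp_growth_const exp_growth_abs exp_growth_poly_exp)
  fix v :: real assume v: "v \<ge> 0"
  have "\<bar>Bcore_deriv k v\<bar> \<le> ?P 1 v * Bmode 1 v + ?P 2 v * Bmode 2 v + \<bar>alpha3\<bar> * (?P 3 v * Bmode 3 v)"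
    using Bmode_pos unfolding Bcore_deriv_def
    by (intro order_trans[OF abs_triangle_ineq] add_mono) (simp_all add: abs_mult less_imp_le)
  also have "\<dots> \<le> ?P 1 v * Bmode 1 v + ?P 2 v * Bmode 1 v + \<bar>alpha3\<bar> * (?P 3 v * Bmode 1 v)"
    by (intro add_mono mult_left_mono Bmode_antimono) auto
  also have "\<dots> = 2 * (?P 1 v + ?P 2 v + \<bar>alpha3\<bar> * ?P 3 v) * (Bmode 1 v / 2)"
    by (simp add: algebra_simps)
  also have "\<dots> \<le> 2 * (?P 1 v + ?P 2 v + \<bar>alpha3\<bar> * ?P 3 v) * Bcore v"
    by (intro mult_left_mono Bcore_ge v) auto
  finally show "\<bar>Bcore_ratio k v\<bar> \<le> 2 * (?P 1 v + ?P 2 v + \<bar>alpha3\<bar> * ?P 3 v)"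
    using Bcore_pos[OF v] by (simp add: Bcore_ratio_def abs_divide field_simps)
qed

lemma a_eq: "a v = - Bcore_ratio 1 v"
  using deriv_Bcore_deriv[of 0] by (simp add: a_def Bcore_ratio_def Bcore_deriv_0)

lemma Psi_eq: "Psi v = 4 * Bcore_deriv 2 v - Bcore_deriv 0 v / 4"
  using deriv_Bcore_deriv[of 0] deriv_Bcore_deriv[of 1]
  by (simp add: Psi_def Bcore_deriv_0 numeral_2_eq_2)

lemma mu_eq: "mu v = 4 * Bcore_ratio 2 v - Bcore_ratio 0 v / 4"
  by (simp add: mu_def Psi_eq Bcore_ratio_def diff_divide_distrib)

definition a' :: "real \<Rightarrow> real" where
  "a' v = (Bcore_ratio 1 v)\<^sup>2 - Bcore_ratio 2 v"

definition mu' :: "real \<Rightarrow> real" where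
  "mu' v = 4 * (Bcore_ratio 3 v - Bcore_ratio 2 v * Bcore_ratio 1 v)"

lemma DERIV_a:
  assumes "v \<ge> 0" shows "(a has_field_derivative a' v) (at v)"
  unfolding a_eq[abs_def]
  by (rule DERIV_cong[OF DERIV_minus[OF DERIV_Bcore_ratio[OF assms]]])
     (simp add: a'_def power2_eq_square numeral_2_eq_2)

lemma DERIV_mu:
  assumes "v \<ge> 0" shows "(mu has_field_derivative mu' v) (at v)"
proof -
  \<comment> \<open>This makes the derivative of the zeroth ratio vanish, which is why
    \<open>mu'\<close> has no term from it.\<close>
  have "Bcore_ratio 0 v = 1" using Bcore_pos[OF assms] by (simp add: Bcore_ratio_def Bcore_deriv_0)
  then show ?thesis
    unfolding mu_eq[abs_def]
    by (intro DERIV_cong[OF DERIV_diff[OF DERIV_cmult[OF DERIV_Bcore_ratio[OF assms]]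
              DERIV_cdivide[OF DERIV_Bcore_ratio[OF assms]]]])
       (simp add: mu'_def numeral_2_eq_2 numeral_3_eq_3)
qed

lemma exp_growth_coeffs: "exp_growth a" "exp_growth mu" "exp_growth a'" "exp_growth mu'"
proof -
  note * = exp_growth_minus exp_growth_diff exp_growth_mult exp_growth_const exp_growth_Bcore_ratio
  show "exp_growth a" unfolding a_eq[abs_def] by (intro *)
  show "exp_growth mu" unfolding mu_eq[abs_def] divide_inverse by (intro *)
  show "exp_growth a'" unfolding a'_def[abs_def] power2_eq_square by (intro *)
  show "exp_growth mu'" unfolding mu'_def[abs_def] by (intro *)
qed

section \<open>Partial derivatives of \<open>C\<close>\<close>

text \<open>The partial derivative of \<open>W\<close> in either variable: the final factor 1/2 is
  the derivative of U in s or t.\<close>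

definition W' :: "real \<Rightarrow> real \<Rightarrow> real \<Rightarrow> real" where
  "W' \<omega> s t = (let U = (s + t) / 2 in (cosh (\<omega> * U) + \<omega> * U * sinh (\<omega> * U)) / 2)"

text \<open>The partial derivative of \<open>C\<close> in its first argument. As \<open>C\<close> is
  symmetric, the one in the second argument is \<open>C' \<omega> t s\<close>.\<close>

definition C' :: "real \<Rightarrow> real \<Rightarrow> real \<Rightarrow> real" where
  "C' \<omega> s t = (W' \<omega> s t * mu s + W \<omega> s t * mu' s) * mu t / Q s t - W \<omega> s t * mu s * mu t * a' s / (Q s t * Q s t)"

lemma Q_ge: "s \<ge> 0 \<Longrightarrow> t \<ge> 0 \<Longrightarrow> Q s t \<ge> 1"
  using a_ge[of s] a_ge[of t] by (simp add: Q_def)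

text \<open>Stated along a curve so that it yields both partial derivatives (one component constant)
  and the derivative along the diagonal shift (both slopes 1).\<close>

lemma DERIV_C:
  assumes f: "(f has_field_derivative f') (at u)" and g: "(g has_field_derivative g') (at u)"
    and nonneg: "f u \<ge> 0" "g u \<ge> 0"
  shows "((\<lambda>u. C \<omega> (f u) (g u)) has_field_derivative C' \<omega> (f u) (g u) * f' + C' \<omega> (g u) (f u) * g') (at u)"
proof -
  have W: "((\<lambda>u. W \<omega> (f u) (g u)) has_field_derivative W' \<omega> (f u) (g u) * (f' + g')) (at u)"
    unfolding W_def W'_def Let_def
    by (rule derivative_eq_intros f g refl | simp)+ (simp add: field_simps)
  have Q: "((\<lambda>u. Q (f u) (g u)) has_field_derivative a' (f u) * f' + a' (g u) * g') (at u)"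
    unfolding Q_def
    by (intro DERIV_add DERIV_chain2[OF DERIV_a f] DERIV_chain2[OF DERIV_a g] nonneg)
  have nz: "Q (f u) (g u) \<noteq> 0" using Q_ge[OF nonneg] by simp
  have sym: "W \<omega> (g u) (f u) = W \<omega> (f u) (g u)" "W' \<omega> (g u) (f u) = W' \<omega> (f u) (g u)"
    "Q (g u) (f u) = Q (f u) (g u)"
    by (simp_all add: W_def W'_def Q_def add.commute)
  show ?thesis
    unfolding C_def C'_def sym
    using nz
    by (intro DERIV_cong[OF DERIV_divide[OF DERIV_mult[OF DERIV_mult[OF W
              DERIV_chain2[OF DERIV_mu f]] DERIV_chain2[OF DERIV_mu g]] Q]] nonneg)
       (simp_all add: field_simps)
qed

lemma D_eq:
  assumes "s \<ge> 0" "t \<ge> 0" shows "D \<omega> s t = C' \<omega> s t + C' \<omega> t s"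
proof -
  \<comment> \<open>Derivatives within the half-line are unique only if z is a limit point of it;
    approach from the right works even at z = 0.\<close>
  have nt: "at z within {0..} \<noteq> bot" if "z \<ge> 0" for z :: real
  proof -
    have "at z within {z<..} \<le> at z within {0..}" using that by (intro at_le) auto
    then show ?thesis using trivial_limit_at_right_real[of z] by (auto simp: bot_unique)
  qed
  have 1: "((\<lambda>\<sigma>. C \<omega> \<sigma> t) has_vector_derivative C' \<omega> s t) (at s within {0..})"
    using DERIV_C[OF DERIV_ident DERIV_const, of s t \<omega>] assms
    by (auto simp: has_real_derivative_iff_has_vector_derivative intro: has_vector_derivative_at_within)
  have 2: "((\<lambda>\<tau>. C \<omega> s \<tau>) has_vector_derivative C' \<omega> t s) (at t within {0..})"
    using DERIV_C[OF DERIV_const DERIV_ident, of s t \<omega>] assms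
    by (auto simp: has_real_derivative_iff_has_vector_derivative intro: has_vector_derivative_at_within)
  show ?thesis
    unfolding D_def using assms
    by (simp add: vector_derivative_within[OF nt 1] vector_derivative_within[OF nt 2])
qed

section \<open>Growth of \<open>W\<close>, \<open>C\<close> and their derivatives\<close>

lemma exp_growth_cosh_sinh:
  shows "exp_growth (\<lambda>u. cosh (c * u))" and "exp_growth (\<lambda>u. sinh (c * u))"
proof -
  have "exp_growth (\<lambda>u. (exp (c * u) + exp (- c * u)) * (1 / 2))" "exp_growth (\<lambda>u. (exp (c * u) - exp (- c * u)) * (1 / 2))"
    by (intro exp_growth_mult exp_growth_add exp_growth_diff exp_growth_exp exp_growth_const)+
  then show "exp_growth (\<lambda>u. cosh (c * u))" "exp_growth (\<lambda>u. sinh (c * u))"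
    by (simp_all add: cosh_field_def sinh_field_def)
qed

lemma exp_growth_W:
  assumes "p \<ge> 0" "q \<ge> 0"
  shows "exp_growth (\<lambda>u. W \<omega> (u + p) (u + q))" and "exp_growth (\<lambda>u. W' \<omega> (u + p) (u + q))"
proof -
  \<comment> \<open>Along the diagonal, U is a plain shift of u, so only one-variable functions need
    bounding.\<close>
  have eq: "(u + p + (u + q)) / 2 = u + (p + q) / 2" for u by simp
  have "exp_growth (\<lambda>U. U * cosh (\<omega> * U))" "exp_growth (\<lambda>U. (cosh (\<omega> * U) + \<omega> * U * sinh (\<omega> * U)) * (1 / 2))"
    by (intro exp_growth_cosh_sinh exp_growth_mult exp_growth_add exp_growth_const exp_growth_id)+
  from this[THEN exp_growth_shift, of "(p + q) / 2"] assms
  show "exp_growth (\<lambda>u. W \<omega> (u + p) (u + q))" "exp_growth (\<lambda>u. W' \<omega> (u + p) (u + q))"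
    unfolding W_def W'_def Let_def eq by simp_all
qed

lemma exp_growth_C:
  assumes "p \<ge> 0" "q \<ge> 0"
  shows "exp_growth (\<lambda>u. C \<omega> (u + p) (u + q))" and "exp_growth (\<lambda>u. C' \<omega> (u + p) (u + q))"
proof -
  have Q: "exp_growth (\<lambda>u. Q (u + p) (u + q))"
    unfolding Q_def using assms by (intro exp_growth_add exp_growth_shift exp_growth_coeffs)
  have Q1: "Q (u + p) (u + q) \<ge> 1" if "u \<ge> 0" for u
    using that assms by (intro Q_ge) auto
  have QQ: "Q (u + p) (u + q) * Q (u + p) (u + q) \<ge> 1" if "u \<ge> 0" for u
    using mult_mono[OF Q1[OF that] Q1[OF that]] Q1[OF that] by simp
  note exp_growth_W[OF assms] exp_growth_coeffs[THEN exp_growth_shift[OF _ assms(1)]]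
    exp_growth_coeffs[THEN exp_growth_shift[OF _ assms(2)]]
  note * = this
  show "exp_growth (\<lambda>u. C \<omega> (u + p) (u + q))"
    unfolding C_def by (rule exp_growth_divide[OF _ Q zero_less_one Q1]) (intro exp_growth_mult *)+
  show "exp_growth (\<lambda>u. C' \<omega> (u + p) (u + q))"
    unfolding C'_def
    by (intro exp_growth_diff exp_growth_divide[OF _ Q zero_less_one Q1]
          exp_growth_divide[OF _ exp_growth_mult[OF Q Q] zero_less_one QQ] exp_growth_mult exp_growth_add *)
qed

section \<open>Decay and integrability against two core factors\<close>

text \<open>One core factor absorbs the growth of \<open>f\<close> and leaves a spare exp (-u); the
  other need only be bounded.\<close>

lemma exp_growth_decay:
  assumes "exp_growth f" "p \<ge> 0" "q \<ge> 0"
  shows "\<exists>K. \<forall>u\<ge>0. \<bar>f u * Bcore (u + p) * Bcore (u + q)\<bar> \<le> K * exp (- u)"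
proof -
  obtain K m where K: "\<forall>u\<ge>0. \<bar>f u\<bar> \<le> K * exp (m * u)" using assms(1) unfolding exp_growth_def by blast
  \<comment> \<open>Nonnegativity of \<open>n\<close> lets the shift \<open>p\<close> be dropped,
    and m - n <= -1 leaves the spare decay.\<close>
  define n where "n = \<bar>m\<bar> + 1"
  obtain L where L: "\<forall>v\<ge>0. Bcore v \<le> L * exp (- n * v)" using Bcore_decay[of n] by blast
  obtain M where M: "\<forall>v\<ge>0. Bcore v \<le> M * exp (- 0 * v)" using Bcore_decay[of 0] by blast
  have L0: "L > 0" using L[rule_format, of 0] Bcore_pos[of 0] by auto
  have M0: "M > 0" using M[rule_format, of 0] Bcore_pos[of 0] by auto
  have K0: "K \<ge> 0" using K[rule_format, of 0] by auto
  have "\<bar>f u * Bcore (u + p) * Bcore (u + q)\<bar> \<le> K * L * M * exp (- u)" if u: "u \<ge> 0" for u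
  proof -
    have "n * u \<le> n * (u + p)" using assms by (intro mult_left_mono) (auto simp: n_def)
    then have "L * exp (- n * (u + p)) \<le> L * exp (- n * u)" using L0 by simp
    then have 1: "Bcore (u + p) \<le> L * exp (- n * u)"
      using L[rule_format, of "u + p"] u assms by simp
    have 2: "Bcore (u + q) \<le> M" using M[rule_format, of "u + q"] u assms by simp
    have pos: "Bcore (u + p) > 0" "Bcore (u + q) > 0" using u assms by (auto intro!: Bcore_pos)
    have "m * u \<le> (n - 1) * u" using u by (intro mult_right_mono) (auto simp: n_def)
    then have e: "exp (m * u) * exp (- n * u) \<le> exp (- u)"
      by (simp add: algebra_simps flip: exp_add)
    have "\<bar>f u * Bcore (u + p) * Bcore (u + q)\<bar> = \<bar>f u\<bar> * Bcore (u + p) * Bcore (u + q)"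
      using pos by (simp add: abs_mult)
    also have "\<dots> \<le> K * exp (m * u) * (L * exp (- n * u)) * M"
      using K u 1 2 pos K0 L0 by (intro mult_mono) auto
    also have "\<dots> = K * L * M * (exp (m * u) * exp (- n * u))" by simp
    also have "\<dots> \<le> K * L * M * exp (- u)" using K0 L0 M0 by (intro mult_left_mono e) auto
    finally show ?thesis .
  qed
  then show ?thesis by blast
qed

lemma set_integrable_exp_decay:
  fixes g :: "real \<Rightarrow> real"
  assumes "continuous_on {0..} g" "\<And>u. u \<ge> 0 \<Longrightarrow> \<bar>g u\<bar> \<le> K * exp (- u)"
  shows "set_integrable lborel {0..} g"
proof (rule set_integrable_bound)
  \<comment> \<open>A nonnegative gauge-integrable function is absolutely integrable for
    \<open>lebesgue\<close>; Borel measurability then transfers this to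
    \<open>lborel\<close>.\<close>
  have "set_integrable lebesgue {0..} (\<lambda>u. exp (- 1 * u) :: real)"
    by (intro nonnegative_absolutely_integrable_1 integrable_on_exp_minus_to_infinity) auto
  then have "set_integrable lborel {0..} (\<lambda>u. exp (- u) :: real)"
    unfolding set_integrable_def by (subst (asm) integrable_completion) simp_all
  then show "set_integrable lborel {0..} (\<lambda>u. K * exp (- u))"
    by (rule set_integrable_mult_right)
  show "set_borel_measurable lborel {0..} g"
    using borel_measurable_continuous_on_indicator[OF _ assms(1)] by (simp add: set_borel_measurable_def)
qed (use assms(2) in \<open>auto intro!: AE_I2 intro: order_trans[OF _ abs_ge_self]\<close>)

lemma continuous_on_Bcore: "continuous_on A Bcore"
  using DERIV_isCont[OF DERIV_Bcore_deriv[of 0]]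
  by (intro continuous_at_imp_continuous_on) (simp add: Bcore_deriv_0)

lemma exp_growth_core_continuous:
  assumes "exp_growth f"
  shows "continuous_on {0..} (\<lambda>u. f u * Bcore (u + p) * Bcore (u + q))"
  using assms unfolding exp_growth_def
  by (intro continuous_intros continuous_on_compose2[OF continuous_on_Bcore[of UNIV]]) auto

lemma exp_growth_core_integrable:
  assumes "exp_growth f" "p \<ge> 0" "q \<ge> 0"
  shows "set_integrable lborel {0..} (\<lambda>u. f u * Bcore (u + p) * Bcore (u + q))"
proof -
  obtain K where "\<forall>u\<ge>0. \<bar>f u * Bcore (u + p) * Bcore (u + q)\<bar> \<le> K * exp (- u)"
    using exp_growth_decay[OF assms] by blast
  then show ?thesis
    by (intro set_integrable_exp_decay[of _ K] exp_growth_core_continuous assms(1)) auto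
qed

lemma exp_growth_core_tendsto:
  assumes "exp_growth f" "p \<ge> 0" "q \<ge> 0"
  shows "((\<lambda>u. f u * Bcore (u + p) * Bcore (u + q)) \<longlongrightarrow> 0) at_top"
proof -
  obtain K where K: "\<forall>u\<ge>0. \<bar>f u * Bcore (u + p) * Bcore (u + q)\<bar> \<le> K * exp (- u)"
    using exp_growth_decay[OF assms] by blast
  have "((\<lambda>u. exp (- u)) \<longlongrightarrow> (0::real)) at_top"
    using filterlim_compose[OF exp_at_bot filterlim_uminus_at_bot_at_top] .
  then have "((\<lambda>u. K * exp (- u)) \<longlongrightarrow> 0) at_top" by (rule tendsto_mult_right_zero)
  then show ?thesis
    by (rule Lim_null_comparison[rotated]) (use K in \<open>auto intro!: eventually_at_top_linorderI[of 0]\<close>)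
qed

section \<open>Integration along the diagonal\<close>

lemma set_integral_FTC_Ici:
  fixes F f :: "real \<Rightarrow> real"
  assumes F: "\<And>u. u \<ge> 0 \<Longrightarrow> (F has_field_derivative f u) (at u)"
    and f: "set_integrable lborel {0..} f" "continuous_on {0..} f" and lim: "(F \<longlongrightarrow> 0) at_top"
  shows "(LBINT u:{0..}. f u) = - F 0"
proof -
  have "((\<lambda>b. LBINT u:{0..b}. f u) \<longlongrightarrow> (LBINT u:{0..}. f u)) at_top"
    using f(1) by (intro tendsto_set_lebesgue_integral_at_top) auto
  moreover have "((\<lambda>b. LBINT u:{0..b}. f u) \<longlongrightarrow> 0 - F 0) at_top"
  proof (rule Lim_transform_eventually)
    show "((\<lambda>b. F b - F 0) \<longlongrightarrow> 0 - F 0) at_top" by (intro tendsto_intros lim)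
    show "\<forall>\<^sub>F b in at_top. F b - F 0 = (LBINT u:{0..b}. f u)"
    proof (rule eventually_at_top_linorderI)
      fix b :: real assume b: "b \<ge> 0"
      show "F b - F 0 = (LBINT u:{0..b}. f u)"
        unfolding set_lebesgue_integral_def
        using b by (intro integral_FTC_atLeastAtMost[symmetric])
          (auto intro!: has_field_derivative_at_within F continuous_on_subset[OF f(2)]
            simp flip: has_real_derivative_iff_has_vector_derivative)
    qed
  qed
  ultimately show ?thesis using tendsto_unique[OF trivial_limit_at_top_linorder] by fastforce
qed

text \<open>Integrability is asserted explicitly because the integral of a non-integrable function
  is 0 by convention, so the identity alone would not express convergence.\<close>

theorem proposition11p1:
  fixes \<omega> x y :: real
  assumes "\<bar>\<omega>\<bar> < 1 / 2" and "x \<ge> 0" and "y \<ge> 0"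
  shows "set_integrable lborel {0..}
           (\<lambda>u. W \<omega> (u + 2 * x) (u + 2 * y) * Psi (u + 2 * x) * Psi (u + 2 * y))
       \<and> set_integrable lborel {0..}
           (\<lambda>u. D \<omega> (u + 2 * x) (u + 2 * y) * Bcore (u + 2 * x) * Bcore (u + 2 * y))
       \<and> K_Psi \<omega> x y = C \<omega> (2 * x) (2 * y) * Bcore (2 * x) * Bcore (2 * y)
           + (LBINT u:{0..}. D \<omega> (u + 2 * x) (u + 2 * y) * Bcore (u + 2 * x) * Bcore (u + 2 * y))"
proof -
  define p q where "p = 2 * x" and "q = 2 * y"
  have pq: "p \<ge> 0" "q \<ge> 0" using assms by (auto simp: p_def q_def)
  define V where "V u = W \<omega> (u + p) (u + q) * mu (u + p) * mu (u + q)" for u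
  define E where "E u = C' \<omega> (u + p) (u + q) + C' \<omega> (u + q) (u + p)" for u
  define BB where "BB f u = f u * Bcore (u + p) * Bcore (u + q)" for f u
  have V: "exp_growth V"
    unfolding V_def by (intro exp_growth_mult exp_growth_W exp_growth_shift exp_growth_coeffs pq)
  have E: "exp_growth E"
    unfolding E_def by (intro exp_growth_add exp_growth_C pq)
  have VE: "exp_growth (\<lambda>u. E u - V u)" by (intro exp_growth_diff V E)
  note int = exp_growth_core_integrable[OF _ pq, folded BB_def]
  have nonneg: "u + p \<ge> 0" "u + q \<ge> 0" if "u \<ge> 0" for u using that pq by auto
  \<comment> \<open>The identity Psi = mu B requires a nonzero core, available here from positivity
    on the half-line.\<close>
  have V_eq: "W \<omega> (u + p) (u + q) * Psi (u + p) * Psi (u + q) = BB V u" if "u \<in> {0..}" for u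
    using Bcore_pos nonneg[of u] that by (simp add: BB_def V_def mu_def less_imp_neq[symmetric])
  have E_eq: "D \<omega> (u + p) (u + q) * Bcore (u + p) * Bcore (u + q) = BB E u" if "u \<in> {0..}" for u
    using that nonneg[of u] by (simp add: BB_def E_def D_eq)
  define F where "F = BB (\<lambda>u. C \<omega> (u + p) (u + q))"
  have "(F has_field_derivative BB (\<lambda>u. E u - V u) u) (at u)" if u: "u \<ge> 0" for u
  proof -
    have B: "((\<lambda>u. Bcore (u + r)) has_field_derivative - a (u + r) * Bcore (u + r)) (at u)" if "r \<ge> 0" for r
      using DERIV_Bcore_deriv[of 0 "u + r"] Bcore_pos[of "u + r"] u that
      by (simp add: Bcore_deriv_0 DERIV_shift a_eq Bcore_ratio_def)
    have lin: "((\<lambda>u. u + r) has_field_derivative 1) (at u)" for r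
      by (auto intro!: derivative_eq_intros)
    \<comment> \<open>The definition of \<open>C\<close> is made for this: multiplying by
      \<open>Q\<close> recovers the weight of the kernel, so the terms -C Q B B from differentiating
      the two cores are exactly minus the kernel integrand.\<close>
    have "C \<omega> (u + p) (u + q) * (a (u + p) + a (u + q)) = V u"
      using Q_ge[OF nonneg[OF u]] by (simp add: C_def V_def Q_def)
    then have V: "V u = C \<omega> (u + p) (u + q) * (a (u + p) + a (u + q))" ..
    show ?thesis
      unfolding F_def BB_def V E_def
      by (rule DERIV_cong[OF DERIV_mult[OF DERIV_mult[OF DERIV_C[OF lin lin nonneg[OF u]]
             B[OF pq(1)]] B[OF pq(2)]]]) (simp add: algebra_simps)
  qed
  moreover have "continuous_on {0..} (BB (\<lambda>u. E u - V u))"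
    unfolding BB_def by (rule exp_growth_core_continuous[OF VE])
  moreover have "(F \<longlongrightarrow> 0) at_top"
    unfolding F_def BB_def by (intro exp_growth_core_tendsto exp_growth_C pq)
  ultimately have "(LBINT u:{0..}. BB (\<lambda>u. E u - V u) u) = - F 0"
    using int[OF VE] by (intro set_integral_FTC_Ici)
  moreover have "(LBINT u:{0..}. BB (\<lambda>u. E u - V u) u) = (LBINT u:{0..}. BB E u) - (LBINT u:{0..}. BB V u)"
    using set_integral_diff(2)[OF int[OF E] int[OF V]] by (simp add: BB_def algebra_simps)
  ultimately have "(LBINT u:{0..}. BB V u) = F 0 + (LBINT u:{0..}. BB E u)" by simp
  moreover have "(LBINT u:{0..}. BB V u) = K_Psi \<omega> x y"
    unfolding K_Psi_def by (rule set_lebesgue_integral_cong) (auto simp: V_eq[unfolded p_def q_def])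
  moreover have "(LBINT u:{0..}. BB E u)
      = (LBINT u:{0..}. D \<omega> (u + p) (u + q) * Bcore (u + p) * Bcore (u + q))"
    by (rule set_lebesgue_integral_cong) (auto simp: E_eq)
  moreover have "set_integrable lborel {0..} (\<lambda>u. W \<omega> (u + p) (u + q) * Psi (u + p) * Psi (u + q))"
    using int[OF V] by (subst set_integrable_cong[OF refl refl V_eq]) auto
  moreover have "set_integrable lborel {0..} (\<lambda>u. D \<omega> (u + p) (u + q) * Bcore (u + p) * Bcore (u + q))"
    using int[OF E] by (subst set_integrable_cong[OF refl refl E_eq]) auto
  ultimately show ?thesis
    by (simp add: F_def BB_def p_def q_def)
qed

end
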